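(* Let $G$ be a finitely generated group, let $\sigma,\tau$ be endomorphisms of $G$, and suppose that $G$ is a $(\sigma,\tau)$-$FC$ group. Then all $(\sigma,\tau)$-derivations of $\mathbb{C}[G]$ are inner if and only if for every $a\in G$ the quotient group $Z_{(\sigma,\tau)}(a)/Z'_{(\sigma,\tau)}(a)$ is periodic, where $Z'_{(\sigma,\tau)}(a)$ is the commutator subgroup of $Z_{(\sigma,\tau)}(a)$.
   Context: The endomorphisms $\sigma,\tau$ are extended linearly to $\mathbb{C}[G]$. A $(\sigma,\tau)$-derivation is a $\mathbb{C}$-linear map $D:\mathbb{C}[G]\to\mathbb{C}[G]$ with $D(ab)=D(a)\tau(b)+\sigma(a)D(b)$ for all $a,b$. It is inner if there is $p\in\mathbb{C}[G]$ with $D(x)=p\tau(x)-\sigma(x)p$ for all $x$. The $(\sigma,\tau)$-conjugacy class of $a\in G$ is $\{\sigma(v)a\tau(v^{-1}) : v\in G\}$; $G$ is a $(\sigma,\tau)$-$FC$ group if every such class is finite. The $(\sigma,\tau)$-centralizer of $a\in G$ is the subgroup $Z_{(\sigma,\tau)}(a)=\{z\in G : \sigma(z)a=a\tau(z)\}$. A group is periodic if all its elements have finite order. *)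

theory Defs
  imports Complex_Main "HOL-Library.Poly_Mapping" "HOL-Algebra.Algebra"
begin

definition finitely_generated_group :: "('a, 'b) monoid_scheme \<Rightarrow> bool" where
  "finitely_generated_group G \<longleftrightarrow>
     (\<exists>S. finite S \<and> S \<subseteq> carrier G \<and> generate G S = carrier G)"

definition periodic_group :: "('a, 'b) monoid_scheme \<Rightarrow> bool" where
  "periodic_group G \<longleftrightarrow>
     (\<forall>x \<in> carrier G. \<exists>n::nat. n > 0 \<and> x [^]\<^bsub>G\<^esub> n = \<one>\<^bsub>G\<^esub>)"

text \<open>
  The complex group algebra of \<open>G\<close> consists of the finitely supported functions on the underlying
  type whose support lies in \<open>carrier G\<close>. Its addition and subtraction are the pointwise ones of
  \<^typ>\<open>'a \<Rightarrow>\<^sub>0 complex\<close>. Its product cannot be the \<open>*\<close> of that type, which convolves with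
  respect to a type-class addition on \<open>'a\<close>; it is \<open>ga_mult\<close> instead.
\<close>

definition group_algebra :: "('a, 'b) monoid_scheme \<Rightarrow> ('a \<Rightarrow>\<^sub>0 complex) set" where
  "group_algebra G = {x. Poly_Mapping.keys x \<subseteq> carrier G}"

definition ga_scale :: "complex \<Rightarrow> ('a \<Rightarrow>\<^sub>0 complex) \<Rightarrow> ('a \<Rightarrow>\<^sub>0 complex)" where
  "ga_scale c x = Poly_Mapping.map (\<lambda>z. c * z) x"

definition ga_mult ::
  "('a, 'b) monoid_scheme \<Rightarrow> ('a \<Rightarrow>\<^sub>0 complex) \<Rightarrow> ('a \<Rightarrow>\<^sub>0 complex) \<Rightarrow> ('a \<Rightarrow>\<^sub>0 complex)" where
  "ga_mult G x y =
     (\<Sum>g \<in> Poly_Mapping.keys x. \<Sum>h \<in> Poly_Mapping.keys y.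
        Poly_Mapping.single (g \<otimes>\<^bsub>G\<^esub> h) (Poly_Mapping.lookup x g * Poly_Mapping.lookup y h))"

definition ga_extend :: "('a \<Rightarrow> 'a) \<Rightarrow> ('a \<Rightarrow>\<^sub>0 complex) \<Rightarrow> ('a \<Rightarrow>\<^sub>0 complex)" where
  "ga_extend \<phi> x =
     (\<Sum>g \<in> Poly_Mapping.keys x. Poly_Mapping.single (\<phi> g) (Poly_Mapping.lookup x g))"

text \<open>
  A map on the group algebra is represented by a total function on the ambient type; only its
  values on \<open>group_algebra G\<close> are constrained.
\<close>

definition twisted_derivation ::
  "('a, 'b) monoid_scheme \<Rightarrow> ('a \<Rightarrow> 'a) \<Rightarrow> ('a \<Rightarrow> 'a)
     \<Rightarrow> (('a \<Rightarrow>\<^sub>0 complex) \<Rightarrow> ('a \<Rightarrow>\<^sub>0 complex)) \<Rightarrow> bool" where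
  "twisted_derivation G \<sigma> \<tau> D \<longleftrightarrow>
     D \<in> group_algebra G \<rightarrow> group_algebra G \<and>
     (\<forall>x \<in> group_algebra G. \<forall>y \<in> group_algebra G. D (x + y) = D x + D y) \<and>
     (\<forall>c. \<forall>x \<in> group_algebra G. D (ga_scale c x) = ga_scale c (D x)) \<and>
     (\<forall>x \<in> group_algebra G. \<forall>y \<in> group_algebra G.
        D (ga_mult G x y) = ga_mult G (D x) (ga_extend \<tau> y) + ga_mult G (ga_extend \<sigma> x) (D y))"

definition inner_twisted_derivation ::
  "('a, 'b) monoid_scheme \<Rightarrow> ('a \<Rightarrow> 'a) \<Rightarrow> ('a \<Rightarrow> 'a)
     \<Rightarrow> (('a \<Rightarrow>\<^sub>0 complex) \<Rightarrow> ('a \<Rightarrow>\<^sub>0 complex)) \<Rightarrow> bool" where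
  "inner_twisted_derivation G \<sigma> \<tau> D \<longleftrightarrow>
     twisted_derivation G \<sigma> \<tau> D \<and>
     (\<exists>p \<in> group_algebra G. \<forall>x \<in> group_algebra G.
        D x = ga_mult G p (ga_extend \<tau> x) - ga_mult G (ga_extend \<sigma> x) p)"

definition twisted_conjugacy_class ::
  "('a, 'b) monoid_scheme \<Rightarrow> ('a \<Rightarrow> 'a) \<Rightarrow> ('a \<Rightarrow> 'a) \<Rightarrow> 'a \<Rightarrow> 'a set" where
  "twisted_conjugacy_class G \<sigma> \<tau> a =
     {\<sigma> v \<otimes>\<^bsub>G\<^esub> a \<otimes>\<^bsub>G\<^esub> \<tau> (inv\<^bsub>G\<^esub> v) | v. v \<in> carrier G}"

definition twisted_FC_group ::
  "('a, 'b) monoid_scheme \<Rightarrow> ('a \<Rightarrow> 'a) \<Rightarrow> ('a \<Rightarrow> 'a) \<Rightarrow> bool" where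
  "twisted_FC_group G \<sigma> \<tau> \<longleftrightarrow>
     (\<forall>a \<in> carrier G. finite (twisted_conjugacy_class G \<sigma> \<tau> a))"

definition twisted_centralizer ::
  "('a, 'b) monoid_scheme \<Rightarrow> ('a \<Rightarrow> 'a) \<Rightarrow> ('a \<Rightarrow> 'a) \<Rightarrow> 'a \<Rightarrow> 'a set" where
  "twisted_centralizer G \<sigma> \<tau> a = {z \<in> carrier G. \<sigma> z \<otimes>\<^bsub>G\<^esub> a = a \<otimes>\<^bsub>G\<^esub> \<tau> z}"

lemma twisted_centralizer_subgroup:
  fixes G (structure)
  assumes "group G" "\<sigma> \<in> hom G G" "\<tau> \<in> hom G G" "a \<in> carrier G"
  shows "subgroup (twisted_centralizer G \<sigma> \<tau> a) G"
proof -
  interpret group G by fact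
  interpret s: group_hom G G \<sigma> by unfold_locales fact
  interpret t: group_hom G G \<tau> by unfold_locales fact
  note a = \<open>a \<in> carrier G\<close>
  show ?thesis
  proof (rule subgroupI)
    fix z assume "z \<in> twisted_centralizer G \<sigma> \<tau> a"
    then have z: "z \<in> carrier G" and eq: "\<sigma> z \<otimes> a = a \<otimes> \<tau> z"
      by (auto simp: twisted_centralizer_def)
    have "inv (\<sigma> z) \<otimes> a = inv (\<sigma> z) \<otimes> (a \<otimes> \<tau> z) \<otimes> inv (\<tau> z)"
      using a z by (simp add: m_assoc)
    also have "\<dots> = a \<otimes> inv (\<tau> z)"
      unfolding eq[symmetric] using a z by (simp add: m_assoc[symmetric])
    finally show "inv z \<in> twisted_centralizer G \<sigma> \<tau> a"
      using z by (simp add: twisted_centralizer_def)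
  next
    fix y z assume "y \<in> twisted_centralizer G \<sigma> \<tau> a" "z \<in> twisted_centralizer G \<sigma> \<tau> a"
    then have y: "y \<in> carrier G" "\<sigma> y \<otimes> a = a \<otimes> \<tau> y" and z: "z \<in> carrier G" "\<sigma> z \<otimes> a = a \<otimes> \<tau> z"
      by (auto simp: twisted_centralizer_def)
    have "\<sigma> y \<otimes> \<sigma> z \<otimes> a = \<sigma> y \<otimes> a \<otimes> \<tau> z"
      using a y(1) z by (simp add: m_assoc)
    also have "\<dots> = a \<otimes> (\<tau> y \<otimes> \<tau> z)"
      using a y z(1) by (simp add: m_assoc)
    finally show "y \<otimes> z \<in> twisted_centralizer G \<sigma> \<tau> a"
      using y(1) z(1) by (simp add: twisted_centralizer_def)
  next
    have "\<one> \<in> twisted_centralizer G \<sigma> \<tau> a"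
      using a by (simp add: twisted_centralizer_def)
    then show "twisted_centralizer G \<sigma> \<tau> a \<noteq> {}" by blast
  qed (auto simp: twisted_centralizer_def)
qed

end

theory Submission
  imports Defs
begin

text \<open>
  Let \<open>G\<close> act on itself by \<open>g \<cdot> h = \<sigma>(g) h \<tau>(g)\<^sup>-\<^sup>1\<close>. The orbits are the twisted conjugacy classes
  and the stabilizers are the twisted centralizers. For a derivation \<open>D\<close> put \<open>c g h\<close> for the
  coefficient of \<open>h \<tau>(g)\<close> in \<open>D(g)\<close>. The twisted Leibniz rule says exactly that \<open>c\<close> is a 1-cocycle of
  this action, that is \<open>c (g g') h = c g h + c g' (g\<^sup>-\<^sup>1 \<cdot> h)\<close> (\<open>Leibniz_iff_cocycle\<close>), and \<open>D\<close> is inner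
  exactly if \<open>c g h = p h - p (g\<^sup>-\<^sup>1 \<cdot> h)\<close> for a finitely supported potential \<open>p\<close>
  (\<open>inner_twisted_derivation_iff\<close>).

  At a point \<open>a\<close> the cocycle restricts to an additive character \<open>z \<mapsto> c z a\<close> of the stabilizer
  \<open>Z(a)\<close>, and as in Shapiro's lemma these characters are the only obstruction. If they all vanish,
  then \<open>c\<close> has a potential (\<open>coboundary_if_zero_on_stabilizers\<close>). Conversely every additive character
  of \<open>Z(a)\<close> comes from a cocycle supported on the orbit of \<open>a\<close> (\<open>induced_cocycle\<close>), hence, the orbit
  being finite, from a derivation; this derivation is not inner unless the character is 0.

  Two finiteness points remain. The potential of a derivation has finite support because the
  cocycle lives on the finitely many finite orbits that meet the supports at finitely many
  generators (\<open>cocycle_finite_support\<close>). And \<open>Z(a)\<close> has no non-zero additive complex character exactly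
  if its abelianization is periodic (\<open>periodic_abelianization_iff\<close>), because an abelian group with an
  element of infinite order always has such a character (\<open>exists_additive_character\<close>).
\<close>

section \<open>Additive characters and periodic abelianizations\<close>

text \<open>
  The additive group of a field of characteristic 0 is divisible, so the homomorphism
  \<open>x [^] n \<mapsto> n\<close> on the infinite cyclic group generated by \<open>x\<close> extends to all of \<open>G\<close>. It
  can be read off from relations: for a subgroup \<open>M\<close> that is maximal among those
  containing no \<open>x [^] n\<close> with \<open>n > 0\<close>, every \<open>y\<close> satisfies a relation \<open>y [^] k \<equiv> x [^] n\<close> modulo
  \<open>M\<close> with \<open>k \<noteq> 0\<close>, and the ratio \<open>n / k\<close> depends only on \<open>y\<close>. This ratio is the required value.
\<close>

lemma (in comm_group) exists_additive_character:
  assumes x: "x \<in> carrier G" and inf: "\<And>n::nat. n > 0 \<Longrightarrow> x [^] n \<noteq> \<one>"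
  obtains f :: "'a \<Rightarrow> 'k::field_char_0"
  where "\<And>y z. y \<in> carrier G \<Longrightarrow> z \<in> carrier G \<Longrightarrow> f (y \<otimes> z) = f y + f z" and "f x = 1"
proof -
  define F where "F = {M. subgroup M G \<and> (\<forall>n::nat. n > 0 \<longrightarrow> x [^] n \<notin> M)}"
  have "\<exists>M\<in>F. \<forall>N\<in>F. M \<subseteq> N \<longrightarrow> N = M"
  proof (rule subset_Zorn_nonempty)
    have "{\<one>} \<in> F"
      using inf by (auto simp: F_def triv_subgroup)
    then show "F \<noteq> {}" by blast
  next
    fix C assume C: "C \<noteq> {}" "subset.chain F C"
    then have "C \<subseteq> F" and tot: "\<And>M N. M \<in> C \<Longrightarrow> N \<in> C \<Longrightarrow> M \<subseteq> N \<or> N \<subseteq> M"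
      by (auto simp: subset.chain_def)
    then have sub: "\<And>M. M \<in> C \<Longrightarrow> subgroup M G"
      and avoid: "\<And>M n. M \<in> C \<Longrightarrow> (n::nat) > 0 \<Longrightarrow> x [^] n \<notin> M"
      by (auto simp: F_def)
    have "subgroup (\<Union>C) G"
    proof (rule subgroupI)
      show "\<Union>C \<subseteq> carrier G" using sub subgroup.subset by blast
      show "\<Union>C \<noteq> {}" using C(1) sub subgroup.one_closed by fastforce
    next
      fix a b assume "a \<in> \<Union>C" "b \<in> \<Union>C"
      then obtain M N where "M \<in> C" "a \<in> M" "N \<in> C" "b \<in> N" by blast
      then show "a \<otimes> b \<in> \<Union>C"
        using tot[of M N] sub subgroup.m_closed by (metis UnionI subsetD)
    next
      fix a assume "a \<in> \<Union>C"
      then obtain N where "N \<in> C" "a \<in> N" by blast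
      then show "inv a \<in> \<Union>C" using subgroup.m_inv_closed[OF sub] by blast
    qed
    then show "\<Union>C \<in> F" using avoid by (auto simp: F_def)
  qed
  then obtain M where MF: "M \<in> F" and max: "\<forall>N\<in>F. M \<subseteq> N \<longrightarrow> N = M" by (rule bexE)
  then have M: "subgroup M G" and avoid: "\<And>n::nat. n > 0 \<Longrightarrow> x [^] n \<notin> M"
    by (auto simp: F_def)
  interpret M: subgroup M G by (rule M)
  have powM: "m [^] (k::int) \<in> M" if "m \<in> M" for m k
    using M subgroup_int_pow_closed that by blast
  have zero: "j = 0" if j: "x [^] (j::int) \<in> M" for j
  proof (rule ccontr)
    assume "j \<noteq> 0"
    have "x [^] (-j) \<in> M"
      using j x by (simp add: int_pow_neg)
    with j have "x [^] (int (nat \<bar>j\<bar>)) \<in> M"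
      by (simp add: abs_if)
    then show False
      using avoid[of "nat \<bar>j\<bar>"] \<open>j \<noteq> 0\<close> by (simp only: int_pow_int)
  qed
  \<comment> \<open>\<open>slope y k n\<close>: the relation \<open>y [^] k \<equiv> x [^] n\<close> modulo \<open>M\<close> assigns the slope \<open>n / k\<close> to \<open>y\<close>.\<close>
  define slope where "slope y k n \<longleftrightarrow> k \<noteq> 0 \<and> y [^] k \<otimes> x [^] (- n) \<in> M" for y and k n :: int
  have ex: "\<exists>k n. slope y k n" if y: "y \<in> carrier G" for y
  proof (cases "y \<in> M")
    case True
    then show ?thesis by (intro exI[of _ 1] exI[of _ 0]) (simp add: slope_def int_pow_1 y)
  next
    case False
    \<comment> \<open>The subgroup generated by \<open>M\<close> and \<open>y\<close> is strictly larger than \<open>M\<close>, so by maximality it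
      contains a positive power of \<open>x\<close>.\<close>
    define N where "N = {m \<otimes> y [^] k | m (k::int). m \<in> M}"
    have sub: "subgroup N G"
    proof (rule subgroupI)
      show "N \<subseteq> carrier G" using y by (auto simp: N_def)
      show "N \<noteq> {}" unfolding N_def using M.one_closed by blast
    next
      fix a assume "a \<in> N"
      then obtain m and k :: int where "a = m \<otimes> y [^] k" "m \<in> M" by (auto simp: N_def)
      then have "inv a = inv m \<otimes> y [^] (-k)" "inv m \<in> M"
        using y by (auto simp: inv_mult int_pow_neg)
      then show "inv a \<in> N" unfolding N_def by blast
    next
      fix a b assume "a \<in> N" "b \<in> N"
      then obtain m m' and k k' :: int where ab: "a = m \<otimes> y [^] k" "m \<in> M" "b = m' \<otimes> y [^] k'" "m' \<in> M"
        by (auto simp: N_def)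
      then have "a \<otimes> b = (m \<otimes> m') \<otimes> y [^] (k + k')"
        using y by (simp add: int_pow_mult m_ac)
      then show "a \<otimes> b \<in> N" unfolding N_def using ab by blast
    qed
    have "M \<subseteq> N"
    proof
      fix m assume "m \<in> M"
      then show "m \<in> N" unfolding N_def mem_Collect_eq
        by (intro exI[of _ m] exI[of _ "0::int"]) simp
    qed
    moreover have "y \<in> N"
      unfolding N_def mem_Collect_eq
      by (intro exI[of _ \<one>] exI[of _ "1::int"]) (use y in \<open>simp add: int_pow_1\<close>)
    ultimately have "N \<notin> F" using max False by auto
    with sub obtain n :: nat where n: "n > 0" "x [^] n \<in> N"
      by (auto simp: F_def)
    then obtain m and k :: int where mk: "x [^] n = m \<otimes> y [^] k" "m \<in> M" by (auto simp: N_def)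
    have "k \<noteq> 0" using avoid[OF n(1)] mk by auto
    have "x [^] (- int n) = inv (m \<otimes> y [^] k)"
      using x mk(1) by (simp add: int_pow_neg int_pow_int)
    then have "y [^] k \<otimes> x [^] (- int n) = inv m"
      using y mk(2) by (simp add: inv_mult m_lcomm[of "y [^] k"])
    then show ?thesis using \<open>k \<noteq> 0\<close> mk(2) unfolding slope_def by (metis M.m_inv_closed)
  qed
  \<comment> \<open>Relations can be raised to powers and multiplied. Opposite exponents on the same element
    eliminate it (slopes are unique); equal exponents show that slopes are additive.\<close>
  have comb: "y [^] (k * a) \<otimes> z [^] (l * b) \<otimes> x [^] (- (n * a + m * b)) \<in> M"
    if "slope y k n" "slope z l m" and yz: "y \<in> carrier G" "z \<in> carrier G" for y z k l n m a b
  proof -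
    have "(y [^] k \<otimes> x [^] (- n)) [^] a \<otimes> (z [^] l \<otimes> x [^] (- m)) [^] b \<in> M"
      using that powM by (auto simp: slope_def)
    also have "(y [^] k \<otimes> x [^] (- n)) [^] a \<otimes> (z [^] l \<otimes> x [^] (- m)) [^] b
        = (y [^] (k * a) \<otimes> x [^] (- n * a)) \<otimes> (z [^] (l * b) \<otimes> x [^] (- m * b))"
      using x yz by (simp add: int_pow_distrib int_pow_pow)
    also have "\<dots> = y [^] (k * a) \<otimes> z [^] (l * b) \<otimes> (x [^] (- n * a) \<otimes> x [^] (- m * b))"
      using x yz by (simp add: m_ac)
    also have "x [^] (- n * a) \<otimes> x [^] (- m * b) = x [^] (- (n * a + m * b))"
      using x by (simp add: int_pow_mult[symmetric])
    finally show ?thesis .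
  qed
  define f :: "'a \<Rightarrow> 'k" where "f y = (SOME q. \<exists>k n. slope y k n \<and> q = of_int n / of_int k)" for y
  have f: "f y = of_int n / of_int k" if s: "slope y k n" and y: "y \<in> carrier G" for y k n
  proof -
    have "\<exists>q::'k. \<exists>k n. slope y k n \<and> q = of_int n / of_int k" using s by blast
    then have "\<exists>k n. slope y k n \<and> f y = of_int n / of_int k" unfolding f_def by (rule someI_ex)
    then obtain k' n' where s': "slope y k' n'" and fy: "f y = of_int n' / of_int k'" by blast
    have "x [^] (- (n * k' + n' * (- k))) \<in> M"
      using comb[OF s s' y y, of k' "-k"] x y by (simp add: int_pow_mult[symmetric] mult.commute)
    then have "n * k' = n' * k" using zero by fastforce
    then have "of_int n * of_int k' = (of_int n' * of_int k :: 'k)" by (metis of_int_mult)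
    moreover have "k \<noteq> 0" "k' \<noteq> 0" using s s' by (auto simp: slope_def)
    ultimately show ?thesis unfolding fy by (simp add: frac_eq_eq)
  qed
  show thesis
  proof (rule that[of f])
    fix y z assume yz: "y \<in> carrier G" "z \<in> carrier G"
    obtain k n l m where s: "slope y k n" "slope z l m" using ex yz by meson
    have "slope (y \<otimes> z) (k * l) (n * l + m * k)"
      using comb[OF s yz, of l k] s yz by (simp add: slope_def int_pow_distrib mult.commute)
    then have "f (y \<otimes> z) = of_int (n * l + m * k) / of_int (k * l)" using f yz by blast
    also have "\<dots> = f y + f z"
      using f[OF s(1) yz(1)] f[OF s(2) yz(2)] s by (simp add: slope_def add_frac_eq)
    finally show "f (y \<otimes> z) = f y + f z" .
  next
    have "slope x 1 1" using x by (simp add: slope_def int_pow_1 int_pow_neg)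
    then show "f x = 1" using f[of x 1 1] x by simp
  qed
qed

lemma (in group) hom_nat_pow_additive:
  fixes \<chi> :: "'a \<Rightarrow> 'k::semiring_1_cancel"
  assumes "\<And>y z. y \<in> carrier G \<Longrightarrow> z \<in> carrier G \<Longrightarrow> \<chi> (y \<otimes> z) = \<chi> y + \<chi> z" "z \<in> carrier G"
  shows "\<chi> (z [^] (n::nat)) = of_nat n * \<chi> z"
proof -
  have "\<chi> \<one> = 0" using assms(1)[of \<one> \<one>] by simp
  then show ?thesis
    by (induction n) (simp_all add: assms algebra_simps)
qed

text \<open>
  A homomorphism to a torsion-free abelian group kills the commutator subgroup and all torsion
  modulo it, which gives one direction; an element of infinite order in the abelianization is
  detected by the character of \<open>exists_additive_character\<close>.
\<close>

lemma (in group) periodic_abelianization_iff: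
  "periodic_group (G Mod derived G (carrier G)) \<longleftrightarrow>
   (\<forall>\<chi> :: 'a \<Rightarrow> 'k::field_char_0.
      (\<forall>y \<in> carrier G. \<forall>z \<in> carrier G. \<chi> (y \<otimes> z) = \<chi> y + \<chi> z) \<longrightarrow> (\<forall>z \<in> carrier G. \<chi> z = 0))"
  (is "?per \<longleftrightarrow> ?triv")
proof -
  let ?D = "derived G (carrier G)"
  interpret D: normal ?D G by (rule derived_self_is_normal)
  interpret A: comm_group "G Mod ?D" by (rule derived_quot_is_comm_group)
  interpret q: group_hom G "G Mod ?D" "\<lambda>z. ?D #> z"
    by unfold_locales (rule D.r_coset_hom_Mod)
  have cosets: "carrier (G Mod ?D) = (\<lambda>z. ?D #> z) ` carrier G"
    by (auto simp: FactGroup_def RCOSETS_def)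
  show ?thesis
  proof
    assume per: ?per
    show ?triv
    proof (intro allI impI ballI)
      fix \<chi> :: "'a \<Rightarrow> 'k" and z
      assume "\<forall>y \<in> carrier G. \<forall>z \<in> carrier G. \<chi> (y \<otimes> z) = \<chi> y + \<chi> z" and z: "z \<in> carrier G"
      then have add: "\<And>y z. y \<in> carrier G \<Longrightarrow> z \<in> carrier G \<Longrightarrow> \<chi> (y \<otimes> z) = \<chi> y + \<chi> z" by blast
      have one: "\<chi> \<one> = 0" using add[of \<one> \<one>] by simp
      have minus: "\<chi> (inv y) = - \<chi> y" if "y \<in> carrier G" for y
        using add[of y "inv y"] that one by (simp add: eq_neg_iff_add_eq_0 add.commute)
      have "subgroup {y \<in> carrier G. \<chi> y = 0} G"
        by (rule subgroupI) (use one add minus in auto)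
      then have "?D \<subseteq> {y \<in> carrier G. \<chi> y = 0}"
        unfolding derived_def
        by (intro generate_subgroup_incl) (auto simp: add minus)
      obtain n :: nat where n: "n > 0" "(?D #> z) [^]\<^bsub>G Mod ?D\<^esub> n = \<one>\<^bsub>G Mod ?D\<^esub>"
        using per z by (auto simp: periodic_group_def cosets)
      then have "?D #> (z [^] n) = ?D"
        using z by (simp add: q.hom_nat_pow FactGroup_def)
      then have "z [^] n \<in> ?D"
        using rcos_self[OF nat_pow_closed[OF z] D.subgroup_axioms] by metis
      then have "of_nat n * \<chi> z = 0"
        using \<open>?D \<subseteq> _\<close> hom_nat_pow_additive[of \<chi>, OF add z] by auto
      then show "\<chi> z = 0" using n(1) by simp
    qed
  next
    assume triv: ?triv
    show ?per unfolding periodic_group_def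
    proof (rule ballI, rule ccontr)
      fix Y assume Y: "Y \<in> carrier (G Mod ?D)"
        and "\<not> (\<exists>n::nat>0. Y [^]\<^bsub>G Mod ?D\<^esub> n = \<one>\<^bsub>G Mod ?D\<^esub>)"
      then have "\<And>n::nat. n > 0 \<Longrightarrow> Y [^]\<^bsub>G Mod ?D\<^esub> n \<noteq> \<one>\<^bsub>G Mod ?D\<^esub>" by blast
      then obtain f :: "'a set \<Rightarrow> 'k"
        where f: "\<And>y z. y \<in> carrier (G Mod ?D) \<Longrightarrow> z \<in> carrier (G Mod ?D) \<Longrightarrow>
            f (y \<otimes>\<^bsub>G Mod ?D\<^esub> z) = f y + f z" and "f Y = 1"
        using A.exists_additive_character[OF Y] by metis
      obtain x where "x \<in> carrier G" "Y = ?D #> x" using Y cosets by auto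
      then show False
        using triv[rule_format, of "\<lambda>z. f (?D #> z)" x] \<open>f Y = 1\<close> f by simp
    qed
  qed
qed

section \<open>Cocycles of a group action\<close>

context group_action
begin

lemma action_closed: "g \<in> carrier G \<Longrightarrow> h \<in> E \<Longrightarrow> \<phi> g h \<in> E"
  using element_image by blast

lemma action_one: "h \<in> E \<Longrightarrow> \<phi> \<one> h = h"
  using id_eq_one by (metis restrict_apply')

lemma action_inv_cancel:
  assumes "g \<in> carrier G" "h \<in> E"
  shows "\<phi> (inv g) (\<phi> g h) = h" "\<phi> g (\<phi> (inv g) h) = h"
proof -
  interpret group G using group_hom by (simp add: group_hom_def)
  show "\<phi> (inv g) (\<phi> g h) = h" "\<phi> g (\<phi> (inv g) h) = h"
    using assms by (simp_all add: action_one flip: composition_rule)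
qed

lemma action_mem_orbit_iff:
  assumes "g \<in> carrier G" "h \<in> E" "b \<in> E"
  shows "\<phi> g h \<in> orbit G \<phi> b \<longleftrightarrow> h \<in> orbit G \<phi> b"
proof -
  interpret group G using group_hom by (simp add: group_hom_def)
  have move: "\<phi> x k \<in> orbit G \<phi> b" if x: "x \<in> carrier G" and "k \<in> orbit G \<phi> b" for x k
  proof -
    obtain y where y: "y \<in> carrier G" "k = \<phi> y b" using \<open>k \<in> _\<close> by (auto simp: orbit_def)
    have "\<phi> x k = \<phi> (x \<otimes> y) b" using x y assms(3) by (simp add: composition_rule)
    then show ?thesis using x y(1) unfolding orbit_def by blast
  qed
  show ?thesis
    using move[of g h] move[of "inv g" "\<phi> g h"] assms action_inv_cancel(1) by auto
qed

lemma orbit_action: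
  assumes "g \<in> carrier G" "h \<in> E"
  shows "orbit G \<phi> (\<phi> g h) = orbit G \<phi> h"
proof -
  interpret group G using group_hom by (simp add: group_hom_def)
  have gh: "\<phi> g h \<in> E" using assms by (rule action_closed)
  have E: "k \<in> E" if "k \<in> orbit G \<phi> b" "b \<in> E" for k b
    using that action_closed by (auto simp: orbit_def)
  have "k \<in> orbit G \<phi> (\<phi> g h) \<longleftrightarrow> \<phi> g h \<in> orbit G \<phi> k" if "k \<in> E" for k
    using orbit_sym[OF gh that] orbit_sym[OF that gh] by blast
  moreover have "k \<in> orbit G \<phi> h \<longleftrightarrow> h \<in> orbit G \<phi> k" if "k \<in> E" for k
    using orbit_sym[OF assms(2) that] orbit_sym[OF that assms(2)] by blast
  ultimately have "k \<in> orbit G \<phi> (\<phi> g h) \<longleftrightarrow> k \<in> orbit G \<phi> h" if "k \<in> E" for k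
    using action_mem_orbit_iff[OF assms that] that by simp
  then show ?thesis using E gh assms(2) by blast
qed

text \<open>
  These are the 1-cocycles of \<open>G\<close> with values in the functions on \<open>E\<close>. On such functions \<open>G\<close> acts by \<open>(g \<cdot> f) h = f (\<phi> (inv g) h)\<close>, and the equation is
  the usual \<open>c (g \<otimes> g') = c g + g \<cdot> c g'\<close>, read off at each point \<open>h\<close>.
\<close>

definition cocycle :: "('a \<Rightarrow> 'c \<Rightarrow> 'k::ab_group_add) \<Rightarrow> bool" where
  "cocycle c \<longleftrightarrow> (\<forall>g \<in> carrier G. \<forall>g' \<in> carrier G. \<forall>h \<in> E.
     c (g \<otimes> g') h = c g h + c g' (\<phi> (inv g) h))"

lemma cocycleD:
  "cocycle c \<Longrightarrow> g \<in> carrier G \<Longrightarrow> g' \<in> carrier G \<Longrightarrow> h \<in> E \<Longrightarrow>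
   c (g \<otimes> g') h = c g h + c g' (\<phi> (inv g) h)"
  by (simp add: cocycle_def)

lemma cocycle_additive_on_stabilizer:
  assumes "cocycle c" "a \<in> E" "y \<in> stabilizer G \<phi> a" "z \<in> stabilizer G \<phi> a"
  shows "c (y \<otimes> z) a = c y a + c z a"
proof -
  have yz: "y \<in> carrier G" "\<phi> y a = a" "z \<in> carrier G"
    using assms(3,4) by (auto simp: stabilizer_def)
  then have "\<phi> (inv y) a = a" using action_inv_cancel(1)[of y a] assms(2) by simp
  then show ?thesis using cocycleD[OF assms(1), of y z a] yz assms(2) by simp
qed

text \<open>
  On the orbit of a point \<open>a\<close>, a potential \<open>p\<close> with \<open>p a = 0\<close> is forced to be
  \<open>p (\<phi> g a) = c g (\<phi> g a)\<close>. Changing \<open>g\<close> by an element \<open>z\<close> of the stabilizer of \<open>a\<close> changes the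
  right-hand side by \<open>c z a\<close>, so the definition is consistent exactly because these values vanish.
  The second conclusion records that \<open>p\<close> is supported where some \<open>c g\<close> is.
\<close>

lemma coboundary_if_zero_on_stabilizers:
  assumes c: "cocycle c"
    and zero: "\<And>a z. a \<in> E \<Longrightarrow> z \<in> stabilizer G \<phi> a \<Longrightarrow> c z a = 0"
  obtains p where "\<And>g h. g \<in> carrier G \<Longrightarrow> h \<in> E \<Longrightarrow> c g h = p h - p (\<phi> (inv g) h)"
    and "\<And>h. h \<in> E \<Longrightarrow> \<exists>g \<in> carrier G. p h = c g h"
proof -
  interpret group G using group_hom by (simp add: group_hom_def)
  \<comment> \<open>\<open>rep\<close> chooses one point in each orbit, and \<open>t h\<close> moves the chosen point of the orbit of \<open>h\<close>
    to \<open>h\<close>.\<close>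
  define rep where "rep h = (SOME a. a \<in> orbit G \<phi> h)" for h
  have rep: "rep h \<in> orbit G \<phi> h" if "h \<in> E" for h
    unfolding rep_def using orbit_refl[OF that] by (rule someI)
  have rep_E: "rep h \<in> E" if "h \<in> E" for h
    using rep[OF that] that by (auto simp: orbit_def action_closed)
  have "\<exists>g. g \<in> carrier G \<and> \<phi> g (rep h) = h" if "h \<in> E" for h
    using orbit_sym[OF that rep_E[OF that] rep[OF that]] by (auto simp: orbit_def)
  then obtain t where t: "\<And>h. h \<in> E \<Longrightarrow> t h \<in> carrier G \<and> \<phi> (t h) (rep h) = h" by metis
  define p where "p h = c (t h) h" for h
  show thesis
  proof (rule that[of p])
    fix g h assume g: "g \<in> carrier G" and h: "h \<in> E"
    define k where "k = \<phi> (inv g) h"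
    have k: "k \<in> E" and gk: "\<phi> g k = h"
      using g h by (simp_all add: k_def action_closed action_inv_cancel)
    have rk: "rep k = rep h" unfolding rep_def k_def using g h by (simp add: orbit_action)
    have th: "t h \<in> carrier G" "\<phi> (t h) (rep h) = h" and tk: "t k \<in> carrier G" "\<phi> (t k) (rep h) = k"
      using t[OF h] t[OF k] rk by auto
    \<comment> \<open>Both \<open>t h\<close> and \<open>g \<otimes> t k\<close> move the representative to \<open>h\<close>; they differ by the
      stabilizing element \<open>z\<close>.\<close>
    define z where "z = inv (t h) \<otimes> (g \<otimes> t k)"
    have inv_th: "\<phi> (inv (t h)) h = rep h"
      using action_inv_cancel(1)[OF th(1) rep_E[OF h]] th by simp
    have z: "z \<in> stabilizer G \<phi> (rep h)"
      using g th tk rep_E[OF h] gk inv_th by (simp add: stabilizer_def z_def composition_rule)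
    have "c (t h \<otimes> z) h = c (t h) h"
      using cocycleD[OF c th(1), of z h] z h zero[OF rep_E[OF h] z] inv_th
      by (simp add: stabilizer_def)
    moreover have "t h \<otimes> z = g \<otimes> t k"
      using g th tk by (simp add: z_def flip: m_assoc)
    moreover have "c (g \<otimes> t k) h = c g h + c (t k) k"
      using cocycleD[OF c g tk(1) h] by (simp add: k_def)
    ultimately show "c g h = p h - p (\<phi> (inv g) h)"
      by (simp add: p_def k_def)
  qed (use t p_def in blast)
qed

text \<open>
  This is the surjectivity in Shapiro's lemma: an additive character of a stabilizer is induced up
  to a cocycle concentrated on the orbit. With \<open>t h\<close> an element moving \<open>a\<close> to \<open>h\<close>, the elements
  \<open>inv (t h) \<otimes> g \<otimes> t (\<phi> (inv g) h)\<close> stabilize \<open>a\<close> and multiply as a cocycle should.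
\<close>

lemma induced_cocycle:
  assumes a: "a \<in> E"
    and add: "\<And>y z. y \<in> stabilizer G \<phi> a \<Longrightarrow> z \<in> stabilizer G \<phi> a \<Longrightarrow> \<chi> (y \<otimes> z) = \<chi> y + \<chi> z"
  obtains c where "cocycle c" and "\<And>g h. h \<notin> orbit G \<phi> a \<Longrightarrow> c g h = 0"
    and "\<And>z. z \<in> stabilizer G \<phi> a \<Longrightarrow> c z a = \<chi> z"
proof -
  interpret group G using group_hom by (simp add: group_hom_def)
  let ?Z = "stabilizer G \<phi> a" and ?O = "orbit G \<phi> a"
  have "\<exists>g. g \<in> carrier G \<and> \<phi> g a = h" if "h \<in> ?O" for h using that by (auto simp: orbit_def)
  then obtain t where t: "\<And>h. h \<in> ?O \<Longrightarrow> t h \<in> carrier G \<and> \<phi> (t h) a = h" by metis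
  have O: "h \<in> E" if "h \<in> ?O" for h using that a by (auto simp: orbit_def action_closed)
  have O_act: "\<phi> g h \<in> ?O \<longleftrightarrow> h \<in> ?O" if "g \<in> carrier G" "h \<in> E" for g h
    using action_mem_orbit_iff[OF that a] .
  define w where "w g h = inv (t h) \<otimes> g \<otimes> t (\<phi> (inv g) h)" for g h
  have w: "w g h \<in> ?Z" if g: "g \<in> carrier G" and h: "h \<in> ?O" for g h
  proof -
    have k: "\<phi> (inv g) h \<in> ?O" using O_act g O[OF h] h by simp
    have "\<phi> (inv (t h)) h = a" using action_inv_cancel(1)[of "t h" a] t[OF h] a by simp
    moreover have "\<phi> g (\<phi> (inv g) h) = h" using action_inv_cancel(2) g O[OF h] by blast
    moreover have "\<phi> (w g h) a = \<phi> (inv (t h)) (\<phi> g (\<phi> (t (\<phi> (inv g) h)) a))"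
      using t[OF h] t[OF k] g a O[OF k] unfolding w_def
      by (subst composition_rule) (auto simp: composition_rule)
    ultimately have "\<phi> (w g h) a = a" using t[OF k] by simp
    then show ?thesis
      using t[OF h] t[OF k] g by (simp add: w_def stabilizer_def)
  qed
  define c where "c g h = (if h \<in> ?O then \<chi> (w g h) else 0)" for g h
  show thesis
  proof (rule that[of c])
    show "cocycle c" unfolding cocycle_def
    proof (intro ballI)
      fix g g' h assume g: "g \<in> carrier G" "g' \<in> carrier G" and h: "h \<in> E"
      let ?k = "\<phi> (inv g) h"
      have k: "?k \<in> ?O \<longleftrightarrow> h \<in> ?O" using O_act g h by simp
      show "c (g \<otimes> g') h = c g h + c g' ?k"
      proof (cases "h \<in> ?O")
        case True
        have k': "\<phi> (inv g') ?k \<in> ?O" using O_act g h True by (simp add: action_closed)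
        have cc: "t h \<in> carrier G" "t ?k \<in> carrier G" "t (\<phi> (inv g') ?k) \<in> carrier G"
          using t True k k' by blast+
        have "\<phi> (inv (g \<otimes> g')) h = \<phi> (inv g') ?k"
          using g h by (simp add: inv_mult_group composition_rule)
        moreover have "u \<otimes> (inv u \<otimes> v) = v" if "u \<in> carrier G" "v \<in> carrier G" for u v
          using that by (simp flip: m_assoc)
        ultimately have "w (g \<otimes> g') h = w g h \<otimes> w g' ?k"
          using g cc by (simp add: w_def m_assoc)
        then show ?thesis using True k g w by (simp add: c_def add)
      qed (simp add: c_def k)
    qed
  next
    fix z assume z: "z \<in> ?Z"
    have aO: "a \<in> ?O" by (rule orbit_refl[OF a])
    have zc: "z \<in> carrier G" "\<phi> z a = a" using z by (auto simp: stabilizer_def)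
    \<comment> \<open>The chosen \<open>t a\<close> need not be the unit, but it lies in the stabilizer, and
      conjugation by it does not change \<open>\<chi>\<close>.\<close>
    have ta: "t a \<in> ?Z" using t[OF aO] by (simp add: stabilizer_def)
    have inv_z: "\<phi> (inv z) a = a" using action_inv_cancel(1)[of z a] zc a by simp
    interpret Z: subgroup ?Z G by (rule stabilizer_subgroup[OF a])
    have "c z a = \<chi> (inv (t a) \<otimes> z \<otimes> t a)" using aO inv_z by (simp add: c_def w_def)
    also have "\<dots> = \<chi> (inv (t a)) + \<chi> z + \<chi> (t a)" using ta z by (simp add: add)
    also have "\<dots> = \<chi> (inv (t a) \<otimes> t a) + \<chi> z"
      using add[of "inv (t a)" "t a"] ta by (simp add: ac_simps)
    also have "\<chi> (inv (t a) \<otimes> t a) = 0"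
      using add[of \<one> \<one>] ta Z.one_closed Z.mem_carrier by simp
    finally show "c z a = \<chi> z" by simp
  qed (simp add: c_def)
qed

text \<open>
  The union \<open>U\<close> of the orbits meeting the support of some \<open>c s\<close> with \<open>s \<in> S\<close> is invariant, so the
  cocycle identity propagates vanishing outside \<open>U\<close> from the generators to the whole group.
\<close>

lemma cocycle_finite_support:
  assumes c: "cocycle c"
    and S: "finite S" "S \<subseteq> carrier G" "generate G S = carrier G"
    and supp: "\<And>s. s \<in> S \<Longrightarrow> finite {h \<in> E. c s h \<noteq> 0}"
    and orb: "\<And>a. a \<in> E \<Longrightarrow> finite (orbit G \<phi> a)"
  shows "finite {h \<in> E. \<exists>g \<in> carrier G. c g h \<noteq> 0}"
proof -
  interpret group G using group_hom by (simp add: group_hom_def)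
  define U where "U = (\<Union>b \<in> (\<Union>s\<in>S. {h \<in> E. c s h \<noteq> 0}). orbit G \<phi> b)"
  have "finite U" unfolding U_def using S(1) supp orb by auto
  have U_act: "\<phi> g h \<in> U \<longleftrightarrow> h \<in> U" if "g \<in> carrier G" "h \<in> E" for g h
    using action_mem_orbit_iff[OF that] by (auto simp: U_def)
  have one: "c \<one> h = 0" if "h \<in> E" for h
    using cocycleD[OF c, of \<one> \<one> h] that by (simp add: action_one)
  have gen: "c s h = 0" if "s \<in> S" "h \<in> E" "h \<notin> U" for s h
    using that orbit_refl by (fastforce simp: U_def)
  have "\<forall>h \<in> E - U. c g h = 0" if "g \<in> generate G S" for g
    using that
  proof (induction rule: generate.induct)
    case (inv s)
    show ?case
    proof
      fix h assume h: "h \<in> E - U"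
      have s: "s \<in> carrier G" using inv S(2) by blast
      have "0 = c (inv s \<otimes> s) h" using s one h by simp
      also have "\<dots> = c (inv s) h + c s (\<phi> s h)" using cocycleD[OF c, of "inv s" s h] s h by simp
      also have "c s (\<phi> s h) = 0"
        using gen[OF inv] s h U_act[of s h] action_closed by simp
      finally show "c (inv s) h = 0" by simp
    qed
  next
    case (eng g g')
    have "g \<in> carrier G" "g' \<in> carrier G" using eng S(3) by auto
    then show ?case
      using eng U_act cocycleD[OF c] action_closed by simp
  qed (use one gen in auto)
  then have "{h \<in> E. \<exists>g \<in> carrier G. c g h \<noteq> 0} \<subseteq> U" using S(3) by auto
  then show ?thesis using \<open>finite U\<close> finite_subset by blast
qed

end

section \<open>Linear extension in the group algebra\<close>

lemma lookup_ga_scale [simp]: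
  "Poly_Mapping.lookup (ga_scale c x) k = c * Poly_Mapping.lookup x k"
  by (simp add: ga_scale_def map.rep_eq when_def)

lemma keys_ga_scale: "Poly_Mapping.keys (ga_scale c x) \<subseteq> Poly_Mapping.keys x"
  by (auto simp: in_keys_iff)

lemma ga_scale_add: "ga_scale c (x + y) = ga_scale c x + ga_scale c y"
  by (rule poly_mapping_eqI) (simp add: lookup_add algebra_simps)

lemma ga_scale_diff: "ga_scale c (x - y) = ga_scale c x - ga_scale c y"
  by (rule poly_mapping_eqI) (simp add: lookup_minus algebra_simps)

lemma ga_scale_left_add: "ga_scale (c + d) x = ga_scale c x + ga_scale d x"
  by (rule poly_mapping_eqI) (simp add: lookup_add algebra_simps)

lemma ga_scale_scale: "ga_scale c (ga_scale d x) = ga_scale (c * d) x"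
  by (rule poly_mapping_eqI) simp

lemma ga_scale_zero [simp]: "ga_scale 0 x = 0" "ga_scale c 0 = 0"
  by (rule poly_mapping_eqI, simp)+

lemma ga_scale_one [simp]: "ga_scale 1 x = x"
  by (rule poly_mapping_eqI) simp

lemma ga_scale_single: "ga_scale c (Poly_Mapping.single g d) = Poly_Mapping.single g (c * d)"
  by (rule poly_mapping_eqI) (simp add: lookup_single when_def)

lemma ga_scale_sum: "ga_scale c (\<Sum>i\<in>I. f i) = (\<Sum>i\<in>I. ga_scale c (f i))"
  by (rule poly_mapping_eqI) (simp add: lookup_sum sum_distrib_left)

text \<open>
  Product, endomorphism extension and the derivations constructed later are all linear extensions
  of maps given on group elements, so linearity has to be shown only once.
\<close>

definition linear_ext :: "('a \<Rightarrow> ('b \<Rightarrow>\<^sub>0 complex)) \<Rightarrow> ('a \<Rightarrow>\<^sub>0 complex) \<Rightarrow> ('b \<Rightarrow>\<^sub>0 complex)" where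
  "linear_ext f x = (\<Sum>g \<in> Poly_Mapping.keys x. ga_scale (Poly_Mapping.lookup x g) (f g))"

lemma linear_ext_superset:
  assumes "finite S" "Poly_Mapping.keys x \<subseteq> S"
  shows "linear_ext f x = (\<Sum>g \<in> S. ga_scale (Poly_Mapping.lookup x g) (f g))"
  unfolding linear_ext_def using assms
  by (intro sum.mono_neutral_left) (auto simp: in_keys_iff)

lemma linear_ext_add: "linear_ext f (x + y) = linear_ext f x + linear_ext f y"
proof -
  let ?S = "Poly_Mapping.keys x \<union> Poly_Mapping.keys y"
  have "Poly_Mapping.keys (x + y) \<subseteq> ?S" by (rule keys_add)
  then show ?thesis
    by (simp add: linear_ext_superset[where S = ?S] lookup_add ga_scale_left_add sum.distrib)
qed

lemma linear_ext_scale: "linear_ext f (ga_scale c x) = ga_scale c (linear_ext f x)"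
  by (simp add: linear_ext_superset[where S = "Poly_Mapping.keys x"] keys_ga_scale
      ga_scale_sum ga_scale_scale)

lemma linear_ext_single [simp]: "linear_ext f (Poly_Mapping.single g c) = ga_scale c (f g)"
  by (subst linear_ext_superset[where S = "{g}"]) auto

lemma linear_ext_zero [simp]: "linear_ext f 0 = 0"
  by (simp add: linear_ext_def)

lemma linear_ext_fun_add: "linear_ext (\<lambda>g. f g + f' g) x = linear_ext f x + linear_ext f' x"
  by (simp add: linear_ext_def ga_scale_add sum.distrib)

lemma linear_ext_fun_scale: "linear_ext (\<lambda>g. ga_scale c (f g)) x = ga_scale c (linear_ext f x)"
  by (simp add: linear_ext_def ga_scale_sum ga_scale_scale mult.commute)

lemma ga_extend_eq_linear_ext: "ga_extend \<phi> = linear_ext (\<lambda>g. Poly_Mapping.single (\<phi> g) 1)"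
  by (simp add: fun_eq_iff ga_extend_def linear_ext_def ga_scale_single)

lemma ga_mult_eq_linear_ext:
  "ga_mult G x y = linear_ext (\<lambda>g. linear_ext (\<lambda>h. Poly_Mapping.single (g \<otimes>\<^bsub>G\<^esub> h) 1) y) x"
  by (simp add: ga_mult_def linear_ext_def ga_scale_sum ga_scale_single)

lemma ga_extend_linear:
  "ga_extend \<phi> (x + y) = ga_extend \<phi> x + ga_extend \<phi> y"
  "ga_extend \<phi> (ga_scale c x) = ga_scale c (ga_extend \<phi> x)"
  by (simp_all add: ga_extend_eq_linear_ext linear_ext_add linear_ext_scale)

lemma ga_mult_bilinear:
  "ga_mult G (x + x') y = ga_mult G x y + ga_mult G x' y"
  "ga_mult G x (y + y') = ga_mult G x y + ga_mult G x y'"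
  "ga_mult G (ga_scale c x) y = ga_scale c (ga_mult G x y)"
  "ga_mult G x (ga_scale c y) = ga_scale c (ga_mult G x y)"
  by (simp_all add: ga_mult_eq_linear_ext linear_ext_add linear_ext_scale linear_ext_fun_add
      linear_ext_fun_scale)

lemma ga_mult_zero [simp]: "ga_mult G 0 y = 0" "ga_mult G x 0 = 0"
  by (simp_all add: ga_mult_def)

lemma ga_extend_zero [simp]: "ga_extend \<phi> 0 = 0"
  by (simp add: ga_extend_def)

lemma ga_extend_monomial [simp]:
  "ga_extend \<phi> (Poly_Mapping.single g 1) = Poly_Mapping.single (\<phi> g) 1"
  by (simp add: ga_extend_eq_linear_ext)

lemma ga_mult_monomials [simp]:
  "ga_mult G (Poly_Mapping.single g 1) (Poly_Mapping.single h 1) = Poly_Mapping.single (g \<otimes>\<^bsub>G\<^esub> h) 1"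
  by (simp add: ga_mult_eq_linear_ext)

lemma group_algebra_monomial [simp]: "Poly_Mapping.single g 1 \<in> group_algebra G \<longleftrightarrow> g \<in> carrier G"
  by (simp add: group_algebra_def)

lemma group_algebra_add: "x \<in> group_algebra G \<Longrightarrow> y \<in> group_algebra G \<Longrightarrow> x + y \<in> group_algebra G"
  using keys_add[of x y] by (auto simp: group_algebra_def)

lemma group_algebra_scale: "x \<in> group_algebra G \<Longrightarrow> ga_scale c x \<in> group_algebra G"
  using keys_ga_scale[of c x] by (auto simp: group_algebra_def)

lemma group_algebra_diff: "x \<in> group_algebra G \<Longrightarrow> y \<in> group_algebra G \<Longrightarrow> x - y \<in> group_algebra G"
  using keys_diff[of x y] by (auto simp: group_algebra_def)

lemma group_algebra_lookup:
  "x \<in> group_algebra G \<Longrightarrow> k \<notin> carrier G \<Longrightarrow> Poly_Mapping.lookup x k = 0"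
  by (auto simp: group_algebra_def in_keys_iff)

lemma group_algebra_zero: "0 \<in> group_algebra G"
  by (simp add: group_algebra_def)

lemma group_algebra_induct [consumes 1, case_names zero monomial scale add]:
  assumes x: "x \<in> group_algebra G"
    and zero: "P 0"
    and monomial: "\<And>g. g \<in> carrier G \<Longrightarrow> P (Poly_Mapping.single g 1)"
    and scale: "\<And>c x. x \<in> group_algebra G \<Longrightarrow> P x \<Longrightarrow> P (ga_scale c x)"
    and add: "\<And>x y. x \<in> group_algebra G \<Longrightarrow> y \<in> group_algebra G \<Longrightarrow> P x \<Longrightarrow> P y \<Longrightarrow> P (x + y)"
  shows "P x"
proof -
  let ?m = "\<lambda>g. ga_scale (Poly_Mapping.lookup x g) (Poly_Mapping.single g 1)"
  have "sum ?m A \<in> group_algebra G \<and> P (sum ?m A)"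
    if "finite A" "A \<subseteq> carrier G" for A
    using that
    by (induction rule: finite_induct)
      (auto intro!: zero add scale monomial group_algebra_add group_algebra_scale
        simp: group_algebra_zero)
  then have "P (\<Sum>g\<in>Poly_Mapping.keys x. ?m g)"
    using x by (simp add: group_algebra_def)
  also have "(\<Sum>g\<in>Poly_Mapping.keys x. ?m g) = x"
    by (rule poly_mapping_eqI)
      (simp add: lookup_sum lookup_single when_def in_keys_iff if_distrib cong: if_cong)
  finally show ?thesis .
qed

lemma linear_ext_in_group_algebra:
  assumes "x \<in> group_algebra G" "\<And>g. g \<in> carrier G \<Longrightarrow> f g \<in> group_algebra G"
  shows "linear_ext f x \<in> group_algebra G"
  using assms(1)
  by (induction rule: group_algebra_induct)
    (simp_all add: assms(2) linear_ext_add linear_ext_scale group_algebra_add group_algebra_scale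
      group_algebra_zero)

section \<open>Twisted derivations as cocycles\<close>

locale endomorphism_pair = group G for G (structure) +
  fixes \<sigma> \<tau> :: "'a \<Rightarrow> 'a"
  assumes sigma_hom: "\<sigma> \<in> hom G G" and tau_hom: "\<tau> \<in> hom G G"
begin

sublocale sigma: group_hom G G \<sigma> by unfold_locales (rule sigma_hom)
sublocale tau: group_hom G G \<tau> by unfold_locales (rule tau_hom)

text \<open>
  Restricting to the carrier makes each \<open>twisted_act g\<close> extensional, as the elements of
  \<open>BijGroup (carrier G)\<close> have to be.
\<close>

definition twisted_act :: "'a \<Rightarrow> 'a \<Rightarrow> 'a" where
  "twisted_act g = (\<lambda>h \<in> carrier G. \<sigma> g \<otimes> h \<otimes> inv (\<tau> g))"

lemma twisted_act_eq: "h \<in> carrier G \<Longrightarrow> twisted_act g h = \<sigma> g \<otimes> h \<otimes> inv (\<tau> g)"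
  by (simp add: twisted_act_def)

lemma twisted_act_inv_eq:
  "g \<in> carrier G \<Longrightarrow> h \<in> carrier G \<Longrightarrow> twisted_act (inv g) h = inv (\<sigma> g) \<otimes> h \<otimes> \<tau> g"
  by (simp add: twisted_act_def)

lemma twisted_act_closed:
  "g \<in> carrier G \<Longrightarrow> h \<in> carrier G \<Longrightarrow> twisted_act g h \<in> carrier G"
  by (simp add: twisted_act_def)

lemma twisted_act_mult:
  assumes "g \<in> carrier G" "g' \<in> carrier G" "h \<in> carrier G"
  shows "twisted_act (g \<otimes> g') h = twisted_act g (twisted_act g' h)"
  using assms by (simp add: twisted_act_def inv_mult_group m_assoc)

lemma twisted_act_Bij:
  assumes "g \<in> carrier G"
  shows "twisted_act g \<in> Bij (carrier G)"
proof -
  have "bij_betw (twisted_act g) (carrier G) (carrier G)"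
  proof (rule bij_betw_byWitness[where f' = "twisted_act (inv g)"])
    have one: "twisted_act \<one> h = h" if "h \<in> carrier G" for h
      using that by (simp add: twisted_act_eq)
    show "\<forall>h\<in>carrier G. twisted_act (inv g) (twisted_act g h) = h"
      using assms one twisted_act_mult[of "inv g" g] by simp
    show "\<forall>h\<in>carrier G. twisted_act g (twisted_act (inv g) h) = h"
      using assms one twisted_act_mult[of g "inv g"] by simp
  qed (use assms in \<open>auto simp: twisted_act_closed\<close>)
  then show ?thesis by (simp add: Bij_def twisted_act_def)
qed

sublocale twisted: group_action G "carrier G" twisted_act
proof -
  have "twisted_act \<in> hom G (BijGroup (carrier G))"
    by (rule homI)
      (auto simp: BijGroup_def twisted_act_Bij compose_def twisted_act_mult fun_eq_iff,
       auto simp: twisted_act_def)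
  then show "group_action G (carrier G) twisted_act"
    by (simp add: group_action_def group_hom_def group_hom_axioms_def group_BijGroup)
qed

lemma orbit_twisted_act:
  "a \<in> carrier G \<Longrightarrow> orbit G twisted_act a = twisted_conjugacy_class G \<sigma> \<tau> a"
  unfolding orbit_def twisted_conjugacy_class_def
  by (intro Collect_cong ex_cong1) (auto simp: twisted_act_eq)

lemma stabilizer_twisted_act:
  assumes "a \<in> carrier G"
  shows "stabilizer G twisted_act a = twisted_centralizer G \<sigma> \<tau> a"
proof -
  have "\<sigma> z \<otimes> a \<otimes> inv (\<tau> z) = a \<longleftrightarrow> \<sigma> z \<otimes> a = a \<otimes> \<tau> z" if "z \<in> carrier G" for z
    using inv_solve_right'[of a "\<sigma> z \<otimes> a" "\<tau> z"] assms that by simp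
  then show ?thesis
    using assms by (auto simp: stabilizer_def twisted_centralizer_def twisted_act_eq)
qed

text \<open>
  Right translation permutes the group. This is used with \<open>u = \<tau> g\<close> to compare derivation values
  \<open>D(g)\<close>, whose coefficients are read at the points \<open>h \<tau>(g)\<close>.
\<close>

lemma group_algebra_eq_iff_shifted:
  assumes "x \<in> group_algebra G" "y \<in> group_algebra G" "u \<in> carrier G"
  shows "x = y \<longleftrightarrow>
    (\<forall>h \<in> carrier G. Poly_Mapping.lookup x (h \<otimes> u) = Poly_Mapping.lookup y (h \<otimes> u))"
proof
  assume eq: "\<forall>h \<in> carrier G. Poly_Mapping.lookup x (h \<otimes> u) = Poly_Mapping.lookup y (h \<otimes> u)"
  show "x = y"
  proof (rule poly_mapping_eqI)
    fix k
    show "Poly_Mapping.lookup x k = Poly_Mapping.lookup y k"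
    proof (cases "k \<in> carrier G")
      case True
      then have "k \<otimes> inv u \<in> carrier G" "k \<otimes> inv u \<otimes> u = k"
        using assms(3) by (simp_all add: m_assoc)
      then show ?thesis using eq by metis
    qed (use assms group_algebra_lookup in metis)
  qed
qed simp

lemma lookup_ga_mult_monomial_right:
  assumes "x \<in> group_algebra G" "u \<in> carrier G" "k \<in> carrier G"
  shows "Poly_Mapping.lookup (ga_mult G x (Poly_Mapping.single u 1)) k =
    Poly_Mapping.lookup x (k \<otimes> inv u)"
  using assms(1)
proof (induction rule: group_algebra_induct)
  case (monomial g)
  then have "g \<otimes> u = k \<longleftrightarrow> g = k \<otimes> inv u"
    using inv_solve_right[of g k u] assms by auto
  then show ?case by (simp add: lookup_single when_def)
qed (simp_all add: ga_mult_bilinear lookup_add)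

lemma lookup_ga_mult_monomial_left:
  assumes "x \<in> group_algebra G" "u \<in> carrier G" "k \<in> carrier G"
  shows "Poly_Mapping.lookup (ga_mult G (Poly_Mapping.single u 1) x) k =
    Poly_Mapping.lookup x (inv u \<otimes> k)"
  using assms(1)
proof (induction rule: group_algebra_induct)
  case (monomial g)
  then have "u \<otimes> g = k \<longleftrightarrow> g = inv u \<otimes> k"
    using inv_solve_left[of g u k] assms by auto
  then show ?case by (simp add: lookup_single when_def)
qed (simp_all add: ga_mult_bilinear lookup_add)

lemma ga_mult_closed:
  assumes "x \<in> group_algebra G" "y \<in> group_algebra G"
  shows "ga_mult G x y \<in> group_algebra G"
  unfolding ga_mult_eq_linear_ext using assms
  by (intro linear_ext_in_group_algebra) auto

text \<open>
  These are the coefficients of \<open>D(g) \<tau>(g)\<^sup>-\<^sup>1\<close>. The translation by \<open>\<tau>(g)\<close> turns the twisted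
  bimodule identity of \<open>D\<close> into the cocycle identity for the single left action \<open>twisted_act\<close>.
\<close>

definition twisted_coeff :: "(('a \<Rightarrow>\<^sub>0 complex) \<Rightarrow> ('a \<Rightarrow>\<^sub>0 complex)) \<Rightarrow> 'a \<Rightarrow> 'a \<Rightarrow> complex" where
  "twisted_coeff D g h = Poly_Mapping.lookup (D (Poly_Mapping.single g 1)) (h \<otimes> \<tau> g)"

lemma finite_twisted_coeff:
  assumes "g \<in> carrier G"
  shows "finite {h \<in> carrier G. twisted_coeff D g h \<noteq> 0}"
proof (rule finite_imageD)
  let ?A = "{h \<in> carrier G. twisted_coeff D g h \<noteq> 0}"
  have "(\<lambda>h. h \<otimes> \<tau> g) ` ?A \<subseteq> Poly_Mapping.keys (D (Poly_Mapping.single g 1))"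
    by (auto simp: twisted_coeff_def in_keys_iff)
  then show "finite ((\<lambda>h. h \<otimes> \<tau> g) ` ?A)" using finite_keys finite_subset by blast
  show "inj_on (\<lambda>h. h \<otimes> \<tau> g) ?A" using assms by (auto simp: inj_on_def)
qed

text \<open>
  Compare coefficients at \<open>h \<tau>(g g')\<close>. Dividing by \<open>\<tau>(g')\<close> on the right leaves \<open>h \<tau>(g)\<close>, and
  dividing by \<open>\<sigma>(g)\<close> on the left leaves \<open>\<sigma>(g)\<^sup>-\<^sup>1 h \<tau>(g) \<tau>(g')\<close>, which is \<open>h\<close> moved by the inverse of
  \<open>g\<close> and then translated by \<open>\<tau>(g')\<close>.
\<close>

lemma Leibniz_iff_cocycle:
  assumes g: "g \<in> carrier G" "g' \<in> carrier G"
    and D: "\<And>g. g \<in> carrier G \<Longrightarrow> D (Poly_Mapping.single g 1) \<in> group_algebra G"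
  shows "D (Poly_Mapping.single (g \<otimes> g') 1) =
      ga_mult G (D (Poly_Mapping.single g 1)) (Poly_Mapping.single (\<tau> g') 1)
      + ga_mult G (Poly_Mapping.single (\<sigma> g) 1) (D (Poly_Mapping.single g' 1)) \<longleftrightarrow>
    (\<forall>h \<in> carrier G. twisted_coeff D (g \<otimes> g') h =
      twisted_coeff D g h + twisted_coeff D g' (twisted_act (inv g) h))"
    (is "?L = ?R \<longleftrightarrow> _")
proof -
  have "?R \<in> group_algebra G" using g D by (intro group_algebra_add ga_mult_closed) auto
  moreover have "?L \<in> group_algebra G" using g D by auto
  ultimately have "?L = ?R \<longleftrightarrow> (\<forall>h \<in> carrier G.
      Poly_Mapping.lookup ?L (h \<otimes> \<tau> (g \<otimes> g')) = Poly_Mapping.lookup ?R (h \<otimes> \<tau> (g \<otimes> g')))"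
    (is "_ \<longleftrightarrow> (\<forall>h \<in> _. ?P h)")
    using g by (intro group_algebra_eq_iff_shifted) auto
  also have "\<dots> \<longleftrightarrow> (\<forall>h \<in> carrier G. twisted_coeff D (g \<otimes> g') h =
      twisted_coeff D g h + twisted_coeff D g' (twisted_act (inv g) h))"
  proof (rule ball_cong[OF refl])
    fix h assume h: "h \<in> carrier G"
    have "h \<otimes> \<tau> (g \<otimes> g') \<otimes> inv (\<tau> g') = h \<otimes> \<tau> g"
      "inv (\<sigma> g) \<otimes> (h \<otimes> \<tau> (g \<otimes> g')) = twisted_act (inv g) h \<otimes> \<tau> g'"
      using g h by (simp_all add: m_assoc twisted_act_inv_eq)
    moreover have "h \<otimes> \<tau> (g \<otimes> g') \<in> carrier G" using g h by simp
    ultimately show "?P h \<longleftrightarrow> twisted_coeff D (g \<otimes> g') h =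
      twisted_coeff D g h + twisted_coeff D g' (twisted_act (inv g) h)"
      using g h D
      by (simp only: twisted_coeff_def lookup_add lookup_ga_mult_monomial_left
          lookup_ga_mult_monomial_right sigma.hom_closed tau.hom_closed)
  qed
  finally show ?thesis .
qed

lemma twisted_derivation_cocycle:
  assumes "twisted_derivation G \<sigma> \<tau> D"
  shows "twisted.cocycle (twisted_coeff D)"
  unfolding twisted.cocycle_def
proof (intro ballI)
  fix g g' h assume g: "g \<in> carrier G" "g' \<in> carrier G" and h: "h \<in> carrier G"
  let ?m = "\<lambda>g. Poly_Mapping.single g 1 :: 'a \<Rightarrow>\<^sub>0 complex"
  have "D (ga_mult G (?m g) (?m g')) =
      ga_mult G (D (?m g)) (ga_extend \<tau> (?m g')) + ga_mult G (ga_extend \<sigma> (?m g)) (D (?m g'))"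
    using assms g unfolding twisted_derivation_def by (simp only: group_algebra_monomial)
  moreover have "D (?m g) \<in> group_algebra G" if "g \<in> carrier G" for g
    using assms that unfolding twisted_derivation_def by auto
  ultimately show "twisted_coeff D (g \<otimes> g') h =
      twisted_coeff D g h + twisted_coeff D g' (twisted_act (inv g) h)"
    using Leibniz_iff_cocycle[OF g, of D] h by simp
qed

text \<open>
  The coefficients prescribe \<open>D\<close> on the group elements, provided that each \<open>c g\<close> has finite support;
  the Leibniz rule then extends by bilinearity.
\<close>

lemma twisted_derivation_of_cocycle:
  assumes c: "twisted.cocycle c"
    and fin: "\<And>g. g \<in> carrier G \<Longrightarrow> finite {h \<in> carrier G. c g h \<noteq> 0}"
  obtains D where "twisted_derivation G \<sigma> \<tau> D"
    and "\<And>g h. g \<in> carrier G \<Longrightarrow> h \<in> carrier G \<Longrightarrow> twisted_coeff D g h = c g h"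
proof -
  let ?m = "\<lambda>g. Poly_Mapping.single g 1 :: 'a \<Rightarrow>\<^sub>0 complex"
  define v where "v g k = (if k \<in> carrier G then c g (k \<otimes> inv (\<tau> g)) else 0)" for g k
  have fin_v: "finite {k. v g k \<noteq> 0}" if g: "g \<in> carrier G" for g
  proof (rule finite_subset)
    show "{k. v g k \<noteq> 0} \<subseteq> (\<lambda>h. h \<otimes> \<tau> g) ` {h \<in> carrier G. c g h \<noteq> 0}"
    proof
      fix k assume "k \<in> {k. v g k \<noteq> 0}"
      then have k: "k \<in> carrier G" "c g (k \<otimes> inv (\<tau> g)) \<noteq> 0" by (auto simp: v_def split: if_splits)
      moreover have "k = k \<otimes> inv (\<tau> g) \<otimes> \<tau> g" using k g by (simp add: m_assoc)
      ultimately show "k \<in> (\<lambda>h. h \<otimes> \<tau> g) ` {h \<in> carrier G. c g h \<noteq> 0}"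
        using g by (intro image_eqI[of _ _ "k \<otimes> inv (\<tau> g)"]) auto
    qed
  qed (use fin g in blast)
  define d where "d g = Abs_poly_mapping (v g)" for g
  have lookup_d: "Poly_Mapping.lookup (d g) = v g" if "g \<in> carrier G" for g
    using fin_v[OF that] by (simp add: d_def)
  have d: "d g \<in> group_algebra G" if "g \<in> carrier G" for g
    by (auto simp: group_algebra_def in_keys_iff lookup_d that v_def split: if_splits)
  define D where "D = linear_ext d"
  have D_m [simp]: "D (?m g) = d g" for g by (simp add: D_def)
  have D_add: "D (x + y) = D x + D y"
    and D_scale: "D (ga_scale e x) = ga_scale e (D x)" and D_zero: "D 0 = 0" for x y e
    by (simp_all add: D_def linear_ext_add linear_ext_scale)
  have coeff: "twisted_coeff D g h = c g h" if "g \<in> carrier G" "h \<in> carrier G" for g h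
    using that by (simp add: twisted_coeff_def lookup_d v_def m_assoc)
  have Leibniz_m: "D (?m (g \<otimes> g')) =
      ga_mult G (D (?m g)) (?m (\<tau> g')) + ga_mult G (?m (\<sigma> g)) (D (?m g'))"
    if g: "g \<in> carrier G" "g' \<in> carrier G" for g g'
  proof (rule Leibniz_iff_cocycle[THEN iffD2, OF g])
    show "\<forall>h \<in> carrier G. twisted_coeff D (g \<otimes> g') h =
        twisted_coeff D g h + twisted_coeff D g' (twisted_act (inv g) h)"
      using g twisted.cocycleD[OF c g] by (simp add: coeff twisted_act_closed)
  qed (simp add: d)
  note lin = D_add D_scale D_zero ga_mult_bilinear ga_extend_linear ga_scale_add
    ga_mult_zero ga_extend_zero
  have "D (ga_mult G x y) = ga_mult G (D x) (ga_extend \<tau> y) + ga_mult G (ga_extend \<sigma> x) (D y)"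
    if "x \<in> group_algebra G" "y \<in> group_algebra G" for x y
    using that(1)
  proof (induction rule: group_algebra_induct)
    case (monomial g)
    from that(2) show ?case
    proof (induction rule: group_algebra_induct)
      case (monomial g')
      then show ?case using Leibniz_m[OF \<open>g \<in> carrier G\<close>] by simp
    qed (simp_all add: lin del: D_m)
  qed (simp_all add: lin)
  moreover have "D \<in> group_algebra G \<rightarrow> group_algebra G"
    unfolding D_def using linear_ext_in_group_algebra d by blast
  ultimately have "twisted_derivation G \<sigma> \<tau> D"
    unfolding twisted_derivation_def by (simp add: D_add D_scale)
  then show thesis using that coeff by blast
qed

text \<open>
  The element \<open>p\<close> itself is the potential: \<open>p \<tau>(g) - \<sigma>(g) p\<close> has coefficient
  \<open>p(h) - p(\<sigma>(g)\<^sup>-\<^sup>1 h \<tau>(g))\<close> at \<open>h \<tau>(g)\<close>. Both sides of the identity for \<open>D\<close> are linear, so group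
  elements suffice.
\<close>

lemma inner_iff_coboundary:
  assumes D: "twisted_derivation G \<sigma> \<tau> D" and p: "p \<in> group_algebra G"
  shows "(\<forall>x \<in> group_algebra G. D x = ga_mult G p (ga_extend \<tau> x) - ga_mult G (ga_extend \<sigma> x) p) \<longleftrightarrow>
    (\<forall>g \<in> carrier G. \<forall>h \<in> carrier G. twisted_coeff D g h =
       Poly_Mapping.lookup p h - Poly_Mapping.lookup p (twisted_act (inv g) h))"
    (is "(\<forall>x \<in> _. ?inner x) \<longleftrightarrow> (\<forall>g \<in> _. ?cob g)")
proof -
  let ?m = "\<lambda>g. Poly_Mapping.single g 1 :: 'a \<Rightarrow>\<^sub>0 complex"
  have closed: "D x \<in> group_algebra G" and D_add: "D (x + y) = D x + D y"
    and D_scale: "D (ga_scale e x) = ga_scale e (D x)"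
    if "x \<in> group_algebra G" "y \<in> group_algebra G" for x y e
    using D that by (auto simp: twisted_derivation_def)
  have on_monomials: "?inner (?m g) \<longleftrightarrow> ?cob g" if g: "g \<in> carrier G" for g
  proof -
    let ?R = "ga_mult G p (?m (\<tau> g)) - ga_mult G (?m (\<sigma> g)) p"
    have "?inner (?m g) \<longleftrightarrow> (\<forall>h \<in> carrier G.
        Poly_Mapping.lookup (D (?m g)) (h \<otimes> \<tau> g) = Poly_Mapping.lookup ?R (h \<otimes> \<tau> g))"
      unfolding ga_extend_monomial using g p closed
      by (intro group_algebra_eq_iff_shifted group_algebra_diff ga_mult_closed) auto
    also have "\<dots> \<longleftrightarrow> ?cob g"
      using g p by (intro ball_cong[OF refl])
        (simp add: twisted_coeff_def lookup_minus lookup_ga_mult_monomial_left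
          lookup_ga_mult_monomial_right twisted_act_inv_eq m_assoc)
    finally show ?thesis .
  qed
  have "?inner x" if mon: "\<forall>g \<in> carrier G. ?inner (?m g)" and x: "x \<in> group_algebra G" for x
    using x
  proof (induction rule: group_algebra_induct)
    case zero
    have "D 0 = D (0 + 0)" by simp
    also have "\<dots> = D 0 + D 0" by (rule D_add) (simp_all add: group_algebra_zero)
    finally show ?case by simp
  next
    case (scale e x)
    then show ?case by (simp add: D_scale ga_extend_linear ga_mult_bilinear ga_scale_diff)
  next
    case (add x y)
    then show ?case by (simp add: D_add ga_extend_linear ga_mult_bilinear)
  qed (use mon in blast)
  then show ?thesis using on_monomials by auto
qed

lemma inner_twisted_derivation_iff:
  assumes D: "twisted_derivation G \<sigma> \<tau> D"
  shows "inner_twisted_derivation G \<sigma> \<tau> D \<longleftrightarrow>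
    (\<exists>p. finite {h \<in> carrier G. p h \<noteq> 0} \<and> (\<forall>g \<in> carrier G. \<forall>h \<in> carrier G.
       twisted_coeff D g h = p h - p (twisted_act (inv g) h)))"
    (is "_ \<longleftrightarrow> (\<exists>p. _ \<and> ?cob p)")
proof
  assume "inner_twisted_derivation G \<sigma> \<tau> D"
  then obtain q where "q \<in> group_algebra G" "?cob (Poly_Mapping.lookup q)"
    using inner_iff_coboundary[OF D] unfolding inner_twisted_derivation_def by blast
  then show "\<exists>p. finite {h \<in> carrier G. p h \<noteq> 0} \<and> ?cob p"
    by (intro exI[of _ "Poly_Mapping.lookup q"]) simp
next
  assume "\<exists>p. finite {h \<in> carrier G. p h \<noteq> 0} \<and> ?cob p"
  then obtain p where fin: "finite {h \<in> carrier G. p h \<noteq> 0}" and cob: "?cob p" by blast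
  define q where "q = Abs_poly_mapping (\<lambda>h. if h \<in> carrier G then p h else 0)"
  have "finite {h. (if h \<in> carrier G then p h else 0) \<noteq> 0}"
    by (rule finite_subset[OF _ fin]) auto
  then have q: "Poly_Mapping.lookup q = (\<lambda>h. if h \<in> carrier G then p h else 0)"
    by (simp add: q_def)
  then have "q \<in> group_algebra G"
    by (auto simp: group_algebra_def in_keys_iff split: if_splits)
  moreover have "?cob (Poly_Mapping.lookup q)"
    using cob by (simp add: q twisted_act_closed)
  ultimately show "inner_twisted_derivation G \<sigma> \<tau> D"
    unfolding inner_twisted_derivation_def using D inner_iff_coboundary by blast
qed

section \<open>Inner derivations and twisted centralizers\<close>

lemma periodic_centralizer_quotient_iff:
  assumes "a \<in> carrier G"
  shows "periodic_group (G\<lparr>carrier := twisted_centralizer G \<sigma> \<tau> a\<rparr> Mod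
      derived G (twisted_centralizer G \<sigma> \<tau> a)) \<longleftrightarrow>
    (\<forall>\<chi> :: 'a \<Rightarrow> complex.
      (\<forall>y \<in> twisted_centralizer G \<sigma> \<tau> a. \<forall>z \<in> twisted_centralizer G \<sigma> \<tau> a.
         \<chi> (y \<otimes> z) = \<chi> y + \<chi> z) \<longrightarrow>
      (\<forall>z \<in> twisted_centralizer G \<sigma> \<tau> a. \<chi> z = 0))"
proof -
  let ?Z = "twisted_centralizer G \<sigma> \<tau> a"
  have Z: "subgroup ?Z G"
    by (rule twisted_centralizer_subgroup[OF group_axioms sigma_hom tau_hom assms])
  interpret Z: group "G\<lparr>carrier := ?Z\<rparr>" by (rule subgroup_imp_group[OF Z])
  have "derived (G\<lparr>carrier := ?Z\<rparr>) ?Z = derived G ?Z"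
    by (rule derived_consistent[OF order_refl Z])
  then show ?thesis
    using Z.periodic_abelianization_iff[where 'k = complex] by simp
qed

text \<open>
  A character of the centralizer induces a cocycle supported on the class of \<open>a\<close>. Finiteness of the
  class makes it the coefficient function of a derivation. A potential for it gives the value
  \<open>p(a) - p(a) = 0\<close> at the elements fixing \<open>a\<close>, where the cocycle equals the character.
\<close>

lemma centralizer_quotient_periodic_if_all_inner:
  assumes a: "a \<in> carrier G" and fin: "finite (twisted_conjugacy_class G \<sigma> \<tau> a)"
    and inner: "\<And>D. twisted_derivation G \<sigma> \<tau> D \<Longrightarrow> inner_twisted_derivation G \<sigma> \<tau> D"
  shows "periodic_group
    (G\<lparr>carrier := twisted_centralizer G \<sigma> \<tau> a\<rparr> Mod derived G (twisted_centralizer G \<sigma> \<tau> a))"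
proof -
  note Z = stabilizer_twisted_act[OF a]
  show ?thesis unfolding periodic_centralizer_quotient_iff[OF a]
  proof (intro allI impI ballI)
    fix \<chi> :: "'a \<Rightarrow> complex" and z
    assume "\<forall>y \<in> twisted_centralizer G \<sigma> \<tau> a. \<forall>z \<in> twisted_centralizer G \<sigma> \<tau> a.
        \<chi> (y \<otimes> z) = \<chi> y + \<chi> z"
      and z: "z \<in> twisted_centralizer G \<sigma> \<tau> a"
    then obtain c where c: "twisted.cocycle c"
      and off: "\<And>g h. h \<notin> orbit G twisted_act a \<Longrightarrow> c g h = 0"
      and on: "\<And>z. z \<in> twisted_centralizer G \<sigma> \<tau> a \<Longrightarrow> c z a = \<chi> z"
      using twisted.induced_cocycle[OF a, of \<chi>] unfolding Z by metis
    have "finite (orbit G twisted_act a)"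
      using fin a by (simp add: orbit_twisted_act)
    then have "finite {h \<in> carrier G. c g h \<noteq> 0}" for g
      by (rule rev_finite_subset) (use off in auto)
    then obtain D where D: "twisted_derivation G \<sigma> \<tau> D"
      and coeff: "\<And>g h. g \<in> carrier G \<Longrightarrow> h \<in> carrier G \<Longrightarrow> twisted_coeff D g h = c g h"
      using twisted_derivation_of_cocycle[OF c] by metis
    then obtain p where p: "\<forall>g \<in> carrier G. \<forall>h \<in> carrier G.
        twisted_coeff D g h = p h - p (twisted_act (inv g) h)"
      using inner inner_twisted_derivation_iff by blast
    have z': "z \<in> carrier G" "twisted_act z a = a"
      using z unfolding Z[symmetric] by (auto simp: stabilizer_def)
    then have "twisted_act (inv z) a = a"
      using twisted.action_inv_cancel(1)[of z a] a by simp
    then have "twisted_coeff D z a = 0" using p z' a by simp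
    then show "\<chi> z = 0" using on[OF z] coeff z' a by simp
  qed
qed

text \<open>
  At each \<open>a\<close> the coefficients of a derivation restrict to an additive character of the centralizer,
  which vanishes by periodicity, so there is a potential. Finite generation and finiteness of the
  classes confine it to a finite set, so that it is an element of the group algebra.
\<close>

lemma all_inner_if_centralizer_quotients_periodic:
  assumes fg: "finitely_generated_group G" and FC: "twisted_FC_group G \<sigma> \<tau>"
    and periodic: "\<And>a. a \<in> carrier G \<Longrightarrow> periodic_group
      (G\<lparr>carrier := twisted_centralizer G \<sigma> \<tau> a\<rparr> Mod derived G (twisted_centralizer G \<sigma> \<tau> a))"
    and D: "twisted_derivation G \<sigma> \<tau> D"
  shows "inner_twisted_derivation G \<sigma> \<tau> D"
proof -
  obtain S where S: "finite S" "S \<subseteq> carrier G" "generate G S = carrier G"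
    using fg by (auto simp: finitely_generated_group_def)
  note c = twisted_derivation_cocycle[OF D]
  have "twisted_coeff D z a = 0" if a: "a \<in> carrier G" and z: "z \<in> stabilizer G twisted_act a" for a z
    using periodic[OF a, unfolded periodic_centralizer_quotient_iff[OF a],
        rule_format, of "\<lambda>z. twisted_coeff D z a"]
      twisted.cocycle_additive_on_stabilizer[OF c a] z
    unfolding stabilizer_twisted_act[OF a] by blast
  then obtain p where p: "\<And>g h. g \<in> carrier G \<Longrightarrow> h \<in> carrier G \<Longrightarrow>
        twisted_coeff D g h = p h - p (twisted_act (inv g) h)"
    and supp: "\<And>h. h \<in> carrier G \<Longrightarrow> \<exists>g \<in> carrier G. p h = twisted_coeff D g h"
    using twisted.coboundary_if_zero_on_stabilizers[OF c] by metis
  have "finite {h \<in> carrier G. \<exists>g \<in> carrier G. twisted_coeff D g h \<noteq> 0}"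
    using FC S finite_twisted_coeff
    by (intro twisted.cocycle_finite_support[OF c S])
      (auto simp: orbit_twisted_act twisted_FC_group_def)
  then have "finite {h \<in> carrier G. p h \<noteq> 0}"
    by (rule rev_finite_subset) (use supp in force)
  then show ?thesis
    using inner_twisted_derivation_iff[OF D] p by blast
qed

end

theorem corollary7:
  fixes G :: "('a, 'b) monoid_scheme" and \<sigma> \<tau> :: "'a \<Rightarrow> 'a"
  assumes "group G"
    and "finitely_generated_group G"
    and "\<sigma> \<in> hom G G" and "\<tau> \<in> hom G G"
    and "twisted_FC_group G \<sigma> \<tau>"
  shows "(\<forall>D. twisted_derivation G \<sigma> \<tau> D \<longrightarrow> inner_twisted_derivation G \<sigma> \<tau> D) \<longleftrightarrow>
    (\<forall>a \<in> carrier G.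
       periodic_group
         (G\<lparr>carrier := twisted_centralizer G \<sigma> \<tau> a\<rparr> Mod derived G (twisted_centralizer G \<sigma> \<tau> a)))"
proof -
  interpret endomorphism_pair G \<sigma> \<tau>
    using assms by (simp add: endomorphism_pair_def endomorphism_pair_axioms_def)
  show ?thesis
    using centralizer_quotient_periodic_if_all_inner
      all_inner_if_centralizer_quotients_periodic[OF assms(2,5)] assms(5)
    unfolding twisted_FC_group_def by blast
qed

end
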